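(* Assume that $f:I\to\mathbb{R}$ is continuous at $0$. Then $$\int_a^b D_{n,q}f(t)\,d_{n,q}t=f(b)-f(a)\qquad\text{for all } a,b\in I.$$
   Context: Fix $0<q<1$ and an odd positive integer $n$. Put $\theta=\infty$ if $n=1$ and $\theta=q^{1/(1-n)}$ if $n\ge 3$; $S=\{0\}$ if $n=1$ and $S=\{-\theta,0,\theta\}$ if $n\ge 3$; $I=(-\theta,\theta)$; $[0]_n=0$ and $[k]_n=\sum_{i=0}^{k-1}n^i$ for $k\ge 1$. The power difference operator is $D_{n,q}f(t)=\dfrac{f(qt^n)-f(t)}{qt^n-t}$ if $t\notin S$, and $D_{n,q}f(t)=f'(t)$ if $t\in S$ (provided the derivative exists). The power integral is defined, for $x\in I$, by $$\int_0^x u(t)\,d_{n,q}t=-\sum_{k=0}^\infty q^{[k]_n}x^{n^k}\bigl(q^{n^k}x^{n^k(n-1)}-1\bigr)u\bigl(q^{[k]_n}x^{n^k}\bigr),$$ and $\int_a^b u\,d_{n,q}t=\int_0^b u\,d_{n,q}t-\int_0^a u\,d_{n,q}t$ for $a,b\in I$. For $x\neq0$ only values of $u$ at nonzero points enter the series, and for $x=0$ every term has the factor $0$ so that the integral is $0$; thus the integral of $D_{n,q}f$ does not depend on the value of $D_{n,q}f$ at $0$. All series that occur are assumed convergent. *)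

theory Defs
  imports "HOL-Analysis.Analysis"
begin

definition power_theta :: "nat \<Rightarrow> real \<Rightarrow> ereal" where
  "power_theta n q = (if n = 1 then \<infinity> else ereal (q powr (1 / (1 - real n))))"

definition power_exceptional :: "nat \<Rightarrow> real \<Rightarrow> real set" where
  "power_exceptional n q =
     (if n = 1 then {0} else {t. ereal t \<in> {- power_theta n q, 0, power_theta n q}})"

definition power_interval :: "nat \<Rightarrow> real \<Rightarrow> real set" where
  "power_interval n q = einterval (- power_theta n q) (power_theta n q)"

definition power_bracket :: "nat \<Rightarrow> nat \<Rightarrow> nat" where
  "power_bracket n k = (\<Sum>i<k. n ^ i)"

text \<open>
  At an exceptional point where \<open>f\<close> is not differentiable, \<^const>\<open>deriv\<close> returns an
  unspecified real number. Within \<^const>\<open>power_interval\<close> the only exceptional point is \<open>0\<close>,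
  and the power integral below does not depend on the value of the integrand there.
\<close>
definition power_diff :: "nat \<Rightarrow> real \<Rightarrow> (real \<Rightarrow> real) \<Rightarrow> real \<Rightarrow> real" where
  "power_diff n q f t =
     (if t \<in> power_exceptional n q then deriv f t
      else (f (q * t ^ n) - f t) / (q * t ^ n - t))"

definition power_integral_term :: "nat \<Rightarrow> real \<Rightarrow> (real \<Rightarrow> real) \<Rightarrow> real \<Rightarrow> nat \<Rightarrow> real" where
  "power_integral_term n q u x k =
     q ^ power_bracket n k * x ^ (n ^ k) * (q ^ (n ^ k) * x ^ (n ^ k * (n - 1)) - 1)
       * u (q ^ power_bracket n k * x ^ (n ^ k))"

definition power_integrable0 :: "nat \<Rightarrow> real \<Rightarrow> (real \<Rightarrow> real) \<Rightarrow> real \<Rightarrow> bool" where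
  "power_integrable0 n q u x \<longleftrightarrow> summable (power_integral_term n q u x)"

definition power_integral0 :: "nat \<Rightarrow> real \<Rightarrow> (real \<Rightarrow> real) \<Rightarrow> real \<Rightarrow> real" where
  "power_integral0 n q u x = - (\<Sum>k. power_integral_term n q u x k)"

definition power_integral :: "nat \<Rightarrow> real \<Rightarrow> (real \<Rightarrow> real) \<Rightarrow> real \<Rightarrow> real \<Rightarrow> real" where
  "power_integral n q u a b = power_integral0 n q u b - power_integral0 n q u a"

end

theory Submission
  imports Defs
begin

text \<open>
  Up to sign, the power integral is a Riemann sum over the orbit \<open>x\<^sub>0 = x\<close>, \<open>x\<^sub>k\<^sub>+\<^sub>1 = q x\<^sub>k\<^sup>n\<close>,
  whose steps are weighted by \<open>x\<^sub>k\<^sub>+\<^sub>1 - x\<^sub>k\<close>; these weights are exactly the denominators of the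
  power difference quotients at the points \<open>x\<^sub>k\<close>.  So the series of a power derivative telescopes:
  its \<open>k\<close>-th term is \<open>f (x\<^sub>k\<^sub>+\<^sub>1) - f (x\<^sub>k)\<close> (lemma \<open>power_integral_term_power_diff\<close>).

  What is left is to see that the orbit tends to \<open>0\<close>.  For \<open>n > 1\<close> the endpoint \<open>\<theta>\<close> of the
  interval is the positive fixed point of \<open>t \<mapsto> q t\<^sup>n\<close>; in all cases \<open>\<bar>x\<bar> < \<theta>\<close> amounts to
  \<open>q \<bar>x\<bar>\<^sup>n\<^sup>-\<^sup>1 < 1\<close> (lemma \<open>mem_power_interval_iff\<close>).  This number bounds the ratio of
  consecutive orbit points, so the orbit stays in the interval and shrinks geometrically, and
  continuity at \<open>0\<close> gives \<open>f (x\<^sub>k) \<longlonglongrightarrow> f 0\<close>.  Hence the integral from \<open>0\<close> to \<open>x\<close> is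
  \<open>f x - f 0\<close> (lemma \<open>power_diff_sums\<close>), and the values \<open>f 0\<close> cancel in the difference of two
  such integrals.
\<close>

lemma power_bracket_Suc: "power_bracket n (Suc k) = 1 + n * power_bracket n k"
  unfolding power_bracket_def by (subst sum.lessThan_Suc_shift) (simp add: sum_distrib_left)

lemma Suc_mult_power_bracket:
  assumes "0 < n"
  shows "Suc ((n - 1) * power_bracket n k) = n ^ k"
proof (induction k)
  case 0
  then show ?case by (simp add: power_bracket_def)
next
  case (Suc k)
  have "(n - 1) * power_bracket n (Suc k) = (n - 1) + n * ((n - 1) * power_bracket n k)"
    by (simp add: power_bracket_Suc algebra_simps)
  then have "Suc ((n - 1) * power_bracket n (Suc k)) = n * Suc ((n - 1) * power_bracket n k)"
    using assms by simp
  then show ?case by (simp only: Suc.IH power_Suc)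
qed

definition power_orbit :: "nat \<Rightarrow> real \<Rightarrow> real \<Rightarrow> nat \<Rightarrow> real" where
  "power_orbit n q x k = q ^ power_bracket n k * x ^ (n ^ k)"

lemma power_orbit_0 [simp]: "power_orbit n q x 0 = x"
  by (simp add: power_orbit_def power_bracket_def)

lemma power_orbit_Suc: "power_orbit n q x (Suc k) = q * power_orbit n q x k ^ n"
  by (simp add: power_orbit_def power_bracket_Suc power_mult_distrib flip: power_mult)
     (simp add: mult.commute)

text \<open>
  The weight in the power integral is the increment of the orbit, since
  \<open>q x\<^sub>k\<^sup>n\<^sup>-\<^sup>1 = q\<^bsup>n^k\<^esup> x\<^bsup>n^k (n-1)\<^esup>\<close> by the closed form of the bracket.
\<close>
lemma power_integral_term_eq_orbit:
  assumes "0 < n"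
  shows "power_integral_term n q u x k =
    (power_orbit n q x (Suc k) - power_orbit n q x k) * u (power_orbit n q x k)"
proof -
  let ?y = "power_orbit n q x k"
  have "q * ?y ^ (n - 1) = q ^ Suc ((n - 1) * power_bracket n k) * x ^ (n ^ k * (n - 1))"
    by (simp add: power_orbit_def power_mult_distrib mult.commute flip: power_mult)
  then have weight: "q ^ (n ^ k) * x ^ (n ^ k * (n - 1)) = q * ?y ^ (n - 1)"
    by (simp only: Suc_mult_power_bracket[OF assms])
  have "power_integral_term n q u x k = ?y * (q * ?y ^ (n - 1) - 1) * u ?y"
    unfolding power_integral_term_def weight by (simp only: power_orbit_def)
  also have "?y * (q * ?y ^ (n - 1) - 1) = q * ?y ^ n - ?y"
    using power_minus_mult[of n ?y] assms by (simp add: algebra_simps)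
  finally show ?thesis by (simp add: power_orbit_Suc)
qed

text \<open>
  For \<open>n > 1\<close> this holds because \<open>\<theta>\<^sup>n\<^sup>-\<^sup>1 = 1 / q\<close> and powers are strictly monotone on \<open>[0, \<infinity>)\<close>; for \<open>n = 1\<close> the
  interval is the whole line and the condition reads \<open>q < 1\<close>.
\<close>
lemma mem_power_interval_iff:
  assumes "0 < q" "q < 1" "0 < n"
  shows "x \<in> power_interval n q \<longleftrightarrow> q * \<bar>x\<bar> ^ (n - 1) < 1"
proof (cases "n = 1")
  case True
  then show ?thesis
    using assms by (simp add: power_interval_def power_theta_def einterval_def)
next
  case False
  define c where "c = q powr (1 / (1 - real n))"
  have "c > 0" using assms by (simp add: c_def)
  have "c ^ (n - 1) = c powr real (n - 1)"
    using \<open>c > 0\<close> by (simp add: powr_realpow)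
  also have "\<dots> = q powr (real (n - 1) / (1 - real n))"
    by (simp add: c_def powr_powr)
  also have "real (n - 1) / (1 - real n) = -1"
    using False assms by (simp add: of_nat_diff field_simps)
  finally have c_power: "c ^ (n - 1) = 1 / q"
    using assms by (simp add: powr_minus_divide)
  have "x \<in> power_interval n q \<longleftrightarrow> \<bar>x\<bar> < c"
    using False by (auto simp: power_interval_def power_theta_def einterval_def c_def)
  also have "\<dots> \<longleftrightarrow> \<bar>x\<bar> ^ (n - 1) < c ^ (n - 1)"
    using power_mono_iff[of c "\<bar>x\<bar>" "n - 1"] False \<open>0 < n\<close> \<open>c > 0\<close> by linarith
  also have "\<dots> \<longleftrightarrow> q * \<bar>x\<bar> ^ (n - 1) < 1"
    unfolding c_power using assms by (simp add: field_simps)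
  finally show ?thesis .
qed

lemma power_exceptional_in_interval:
  assumes "t \<in> power_interval n q" "t \<in> power_exceptional n q"
  shows "t = 0"
  using assms
  by (auto simp: power_interval_def power_exceptional_def einterval_def split: if_splits)

text \<open>
  The ratio \<open>q \<bar>x\<^sub>k\<bar>\<^sup>n\<^sup>-\<^sup>1\<close> of consecutive orbit points grows with \<open>\<bar>x\<^sub>k\<bar>\<close>, so it never exceeds
  its initial value as long as the orbit does not leave \<open>[-\<bar>x\<bar>, \<bar>x\<bar>]\<close>, which the bound itself
  ensures because that initial value is below \<open>1\<close>.
\<close>
lemma abs_power_orbit_le:
  assumes "0 < q" "q < 1" "0 < n" and x: "x \<in> power_interval n q"
  shows "\<bar>power_orbit n q x k\<bar> \<le> \<bar>x\<bar> * (q * \<bar>x\<bar> ^ (n - 1)) ^ k"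
proof (induction k)
  case 0
  then show ?case by simp
next
  case (Suc k)
  let ?y = "power_orbit n q x k" and ?r = "q * \<bar>x\<bar> ^ (n - 1)"
  have r: "0 \<le> ?r" "?r < 1"
    using x assms by (simp_all add: mem_power_interval_iff)
  have "\<bar>x\<bar> * ?r ^ k \<le> \<bar>x\<bar> * 1"
    using r by (intro mult_left_mono power_le_one) auto
  with Suc.IH have "\<bar>?y\<bar> \<le> \<bar>x\<bar>" by linarith
  then have "q * \<bar>?y\<bar> ^ (n - 1) \<le> ?r"
    using assms by (intro mult_left_mono power_mono) auto
  have "\<bar>power_orbit n q x (Suc k)\<bar> = \<bar>?y\<bar> * (q * \<bar>?y\<bar> ^ (n - 1))"
    using power_minus_mult[of n "\<bar>?y\<bar>"] assms
    by (simp add: power_orbit_Suc abs_mult power_abs mult_ac)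
  also have "\<dots> \<le> (\<bar>x\<bar> * ?r ^ k) * ?r"
    using Suc.IH \<open>q * \<bar>?y\<bar> ^ (n - 1) \<le> ?r\<close> r assms by (intro mult_mono) auto
  finally show ?case by (simp add: mult_ac)
qed

lemma power_orbit_in_interval:
  assumes "0 < q" "q < 1" "0 < n" and x: "x \<in> power_interval n q"
  shows "power_orbit n q x k \<in> power_interval n q"
proof -
  let ?r = "q * \<bar>x\<bar> ^ (n - 1)"
  have r: "0 \<le> ?r" "?r < 1"
    using x assms by (simp_all add: mem_power_interval_iff)
  have "\<bar>x\<bar> * ?r ^ k \<le> \<bar>x\<bar> * 1"
    using r by (intro mult_left_mono power_le_one) auto
  with abs_power_orbit_le[OF assms, of k] have "\<bar>power_orbit n q x k\<bar> \<le> \<bar>x\<bar>" by linarith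
  then have "q * \<bar>power_orbit n q x k\<bar> ^ (n - 1) \<le> ?r"
    using assms by (intro mult_left_mono power_mono) auto
  also have "\<dots> < 1" by (rule r)
  finally show ?thesis using assms by (simp only: mem_power_interval_iff)
qed

lemma power_orbit_tendsto_0:
  assumes "0 < q" "q < 1" "0 < n" and x: "x \<in> power_interval n q"
  shows "power_orbit n q x \<longlonglongrightarrow> 0"
proof (rule Lim_null_comparison)
  show "\<forall>\<^sub>F k in sequentially. norm (power_orbit n q x k) \<le> \<bar>x\<bar> * (q * \<bar>x\<bar> ^ (n - 1)) ^ k"
    using abs_power_orbit_le[OF assms] by simp
  have "(\<lambda>k. (q * \<bar>x\<bar> ^ (n - 1)) ^ k) \<longlonglongrightarrow> 0"
    using x assms by (intro LIMSEQ_power_zero) (simp add: mem_power_interval_iff abs_mult)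
  from tendsto_mult_left[OF this, of "\<bar>x\<bar>"]
  show "(\<lambda>k. \<bar>x\<bar> * (q * \<bar>x\<bar> ^ (n - 1)) ^ k) \<longlonglongrightarrow> 0" by simp
qed

text \<open>
  At a nonzero orbit point the weight cancels the denominator of the difference quotient, which
  does not vanish because the interval contains no fixed point of \<open>t \<mapsto> q t\<^sup>n\<close> except \<open>0\<close>.
  Once the orbit is at \<open>0\<close>, it stays there and both sides vanish, whatever the value of
  \<^term>\<open>deriv f 0\<close>.
\<close>
lemma power_integral_term_power_diff:
  assumes "0 < q" "q < 1" "0 < n" and x: "x \<in> power_interval n q"
  shows "power_integral_term n q (power_diff n q f) x k =
    f (power_orbit n q x (Suc k)) - f (power_orbit n q x k)"
proof (cases "power_orbit n q x k = 0")
  case True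
  then show ?thesis
    using assms by (simp add: power_integral_term_eq_orbit power_orbit_Suc zero_power)
next
  case False
  let ?y = "power_orbit n q x k"
  have y: "?y \<in> power_interval n q"
    using power_orbit_in_interval[OF assms] .
  then have "q * \<bar>?y\<bar> ^ (n - 1) < 1"
    using assms by (simp add: mem_power_interval_iff)
  then have "\<bar>q * ?y ^ (n - 1)\<bar> \<noteq> 1"
    using assms by (simp add: abs_mult power_abs)
  then have "?y * (q * ?y ^ (n - 1) - 1) \<noteq> 0"
    using False by auto
  moreover have "?y * (q * ?y ^ (n - 1) - 1) = q * ?y ^ n - ?y"
    using power_minus_mult[of n ?y] assms by (simp add: algebra_simps)
  ultimately have "q * ?y ^ n - ?y \<noteq> 0" by metis
  moreover have "?y \<notin> power_exceptional n q"
    using power_exceptional_in_interval[OF y] False by blast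
  ultimately show ?thesis
    using assms by (simp add: power_integral_term_eq_orbit power_orbit_Suc power_diff_def)
qed

lemma power_diff_sums:
  assumes "0 < q" "q < 1" "0 < n" and x: "x \<in> power_interval n q"
    and f: "continuous (at 0 within power_interval n q) f"
  shows "power_integral_term n q (power_diff n q f) x sums (f 0 - f x)"
proof -
  have "(\<lambda>k. f (power_orbit n q x k)) \<longlonglongrightarrow> f 0"
    using power_orbit_tendsto_0[OF assms(1-4)] power_orbit_in_interval[OF assms(1-4)]
    by (intro continuous_within_tendsto_compose'[OF f]) auto
  from telescope_sums[OF this] show ?thesis
    by (simp add: power_integral_term_power_diff[OF assms(1-4), abs_def])
qed

theorem theorem17:
  fixes q :: real and n :: nat and f :: "real \<Rightarrow> real"
  assumes "0 < q" and "q < 1" and "odd n"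
    and "continuous (at 0 within power_interval n q) f"
  shows "\<forall>a \<in> power_interval n q. \<forall>b \<in> power_interval n q.
           power_integrable0 n q (power_diff n q f) a \<and>
           power_integrable0 n q (power_diff n q f) b \<and>
           power_integral n q (power_diff n q f) a b = f b - f a"
proof -
  have "0 < n" using \<open>odd n\<close> by (rule odd_pos)
  then have sums: "power_integral_term n q (power_diff n q f) x sums (f 0 - f x)"
    if "x \<in> power_interval n q" for x
    using power_diff_sums assms that by blast
  have "power_integrable0 n q (power_diff n q f) x"
    and "power_integral0 n q (power_diff n q f) x = f x - f 0"
    if "x \<in> power_interval n q" for x
    using sums_summable[OF sums[OF that]] sums_unique[OF sums[OF that], symmetric]
    by (simp_all add: power_integrable0_def power_integral0_def)
  then show ?thesis by (simp add: power_integral_def)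
qed

end
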